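(* A bipartite graph $G$ is a forest if and only if $K_{2,2}$ is not a bipartite minor of $G$.
   Context: All graphs are finite and simple. For a graph $G$ and vertex $v$, $G-v$ is the induced subgraph on $V(G)\setminus\{v\}$. If $G$ is bipartite and $u,v$ are in the same part, the contraction of $u$ with $v$ is the graph on $V(G)\setminus\{u\}$ obtained by identifying $u$ with $v$ and deleting the extra copy of each resulting double edge. A cycle $C$ of $G$ is peripheral if it is induced (no two nonadjacent vertices of $C$ are joined by an edge of $G$) and non-separating (removing the vertices of $C$ from $G$ does not increase the number of connected components). A contraction of $u$ with $v$ in a graph $G_i$ is admissible if $u$ and $v$ have a common neighbor $w$ in $G_i$ such that the path $(u,w,v)$ is part of a peripheral cycle of $G_i$. For a bipartite graph $G$, a graph $H$ is a bipartite minor of $G$ if there is a sequence $G=G_0,G_1,\dots,G_t$ with $G_t$ isomorphic to $H$, where each $G_{i+1}$ is obtained from $G_i$ by deleting a vertex, deleting an edge, or performing an admissible contraction. *)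

theory Defs
  imports "Graph_Theory.Graph_Theory"
begin

text \<open>
  Finite simple graphs are \<^locale>\<open>pair_graph\<close>s: finite, loop-free and symmetric, where an
  edge \<open>uv\<close> is represented by the two arcs \<open>(u, v)\<close> and \<open>(v, u)\<close>.
\<close>

definition bipartition :: "'a pair_pre_digraph \<Rightarrow> 'a set \<Rightarrow> 'a set \<Rightarrow> bool" where
  "bipartition G U V \<longleftrightarrow>
     pverts G = U \<union> V \<and> U \<inter> V = {} \<and> parcs G \<subseteq> U \<times> V \<union> V \<times> U"

definition bipartite :: "'a pair_pre_digraph \<Rightarrow> bool" where
  "bipartite G \<longleftrightarrow> (\<exists>U V. bipartition G U V)"

definition same_part :: "'a pair_pre_digraph \<Rightarrow> 'a \<Rightarrow> 'a \<Rightarrow> bool" where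
  "same_part G u v \<longleftrightarrow> (\<exists>U V. bipartition G U V \<and> u \<in> U \<and> v \<in> U)"

text \<open>
  In a symmetric digraph \<^const>\<open>pre_digraph.cycle\<close> also holds of the closed walk \<open>a, b, a\<close>, so
  the library's \<^const>\<open>forest\<close> fails as soon as there is an edge.  The cycles of the undirected
  graph are those of length at least 3; such a cycle is given by its list of arcs, traversed in
  one of the two directions.
\<close>

definition undirected_cycle :: "'a pair_pre_digraph \<Rightarrow> ('a \<times> 'a) awalk \<Rightarrow> bool" where
  "undirected_cycle G p \<longleftrightarrow> pre_digraph.cycle (with_proj G) p \<and> 3 \<le> length p"

definition undirected_forest :: "'a pair_pre_digraph \<Rightarrow> bool" where
  "undirected_forest G \<longleftrightarrow> \<not> (\<exists>p. undirected_cycle G p)"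

definition cycle_verts :: "('a \<times> 'a) awalk \<Rightarrow> 'a set" where
  "cycle_verts p = fst ` set p"

definition induced_cycle :: "'a pair_pre_digraph \<Rightarrow> ('a \<times> 'a) awalk \<Rightarrow> bool" where
  "induced_cycle G p \<longleftrightarrow>
     (\<forall>x\<in>cycle_verts p. \<forall>y\<in>cycle_verts p.
        (x, y) \<in> parcs G \<longrightarrow> (x, y) \<in> set p \<or> (y, x) \<in> set p)"

text \<open>
  In a symmetric digraph the strongly connected components, whose vertex sets form
  \<^const>\<open>pre_digraph.sccs_verts\<close>, are the connected components.
\<close>

definition num_components :: "('a, 'b) pre_digraph \<Rightarrow> nat" where
  "num_components G = card (pre_digraph.sccs_verts G)"

definition nonseparating_cycle :: "'a pair_pre_digraph \<Rightarrow> ('a \<times> 'a) awalk \<Rightarrow> bool" where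
  "nonseparating_cycle G p \<longleftrightarrow>
     num_components (with_proj G \<restriction> (pverts G - cycle_verts p)) \<le> num_components (with_proj G)"

definition peripheral_cycle :: "'a pair_pre_digraph \<Rightarrow> ('a \<times> 'a) awalk \<Rightarrow> bool" where
  "peripheral_cycle G p \<longleftrightarrow>
     undirected_cycle G p \<and> induced_cycle G p \<and> nonseparating_cycle G p"

definition delete_vertex :: "'a pair_pre_digraph \<Rightarrow> 'a \<Rightarrow> 'a pair_pre_digraph" where
  "delete_vertex G v =
     \<lparr> pverts = pverts G - {v}, parcs = {a \<in> parcs G. fst a \<noteq> v \<and> snd a \<noteq> v} \<rparr>"

definition delete_edge :: "'a pair_pre_digraph \<Rightarrow> 'a \<Rightarrow> 'a \<Rightarrow> 'a pair_pre_digraph" where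
  "delete_edge G u v = \<lparr> pverts = pverts G, parcs = parcs G - {(u, v), (v, u)} \<rparr>"

text \<open>
  Contraction of \<open>u\<close> with \<open>v\<close>: the vertex \<open>u\<close> is renamed to \<open>v\<close> in every arc.  As the arcs form a
  set, only one copy of each double edge remains.
\<close>

definition contract :: "'a pair_pre_digraph \<Rightarrow> 'a \<Rightarrow> 'a \<Rightarrow> 'a pair_pre_digraph" where
  "contract G u v =
     \<lparr> pverts = pverts G - {u}, parcs = map_prod (id(u := v)) (id(u := v)) ` parcs G \<rparr>"

definition admissible :: "'a pair_pre_digraph \<Rightarrow> 'a \<Rightarrow> 'a \<Rightarrow> bool" where
  "admissible G u v \<longleftrightarrow> u \<noteq> v \<and> same_part G u v \<and>
     (\<exists>w. (u, w) \<in> parcs G \<and> (v, w) \<in> parcs G \<and>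
        (\<exists>p. peripheral_cycle G p \<and> (u, w) \<in> set p \<and> (w, v) \<in> set p))"

inductive bipartite_minor_step :: "'a pair_pre_digraph \<Rightarrow> 'a pair_pre_digraph \<Rightarrow> bool" where
  delete_vertex: "v \<in> pverts G \<Longrightarrow> bipartite_minor_step G (delete_vertex G v)"
| delete_edge: "(u, v) \<in> parcs G \<Longrightarrow> bipartite_minor_step G (delete_edge G u v)"
| contract: "admissible G u v \<Longrightarrow> bipartite_minor_step G (contract G u v)"

definition bipartite_minor :: "'b pair_pre_digraph \<Rightarrow> 'a pair_pre_digraph \<Rightarrow> bool" where
  "bipartite_minor H G \<longleftrightarrow>
     (\<exists>G'. bipartite_minor_step\<^sup>*\<^sup>* G G' \<and> digraph_iso (with_proj G') (with_proj H))"

definition complete_bipartite :: "nat \<Rightarrow> nat \<Rightarrow> (nat + nat) pair_pre_digraph" where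
  "complete_bipartite m n =
     \<lparr> pverts = Inl ` {..<m} \<union> Inr ` {..<n},
       parcs = Inl ` {..<m} \<times> Inr ` {..<n} \<union> Inr ` {..<n} \<times> Inl ` {..<m} \<rparr>"

lemma complete_bipartite_library: "K\<^bsub>m,n\<^esub> (with_proj (complete_bipartite m n))"
  unfolding complete_bipartite_digraph_pair_def
proof (intro conjI exI)
  show "finite (pverts (complete_bipartite m n))"
    by (simp add: complete_bipartite_def)
  show "pverts (complete_bipartite m n) = Inl ` {..<m} \<union> Inr ` {..<n}"
    by (simp add: complete_bipartite_def)
  show "parcs (complete_bipartite m n) =
      Inl ` {..<m} \<times> Inr ` {..<n} \<union> Inr ` {..<n} \<times> Inl ` {..<m}"
    by (simp add: complete_bipartite_def)
qed (auto simp: card_image)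

lemma with_proj_delete_vertex:
  "with_proj (delete_vertex G v) = pre_digraph.del_vert (with_proj G) v"
  by (auto simp: delete_vertex_def with_proj_def pre_digraph.del_vert_def)

lemma with_proj_delete_edge:
  "with_proj (delete_edge G u v) =
     pre_digraph.del_arc (pre_digraph.del_arc (with_proj G) (u, v)) (v, u)"
  by (auto simp: delete_edge_def with_proj_def pre_digraph.del_arc_def)

lemma pair_graph_contract:
  assumes "pair_graph G" "u \<noteq> v" "same_part G u v"
  shows "pair_graph (contract G u v)"
proof -
  interpret pair_graph G by fact
  from assms(3) obtain U V where B: "pverts G = U \<union> V" "U \<inter> V = {}"
    "parcs G \<subseteq> U \<times> V \<union> V \<times> U" and uv: "u \<in> U" "v \<in> U"
    by (auto simp: same_part_def bipartition_def)
  let ?f = "id(u := v)"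
  have arc: "(x, y) \<in> parcs G \<Longrightarrow> ?f x \<in> pverts G - {u} \<and> ?f y \<in> pverts G - {u} \<and> ?f x \<noteq> ?f y"
    for x y using B uv assms(2) by (auto dest: wellformed')
  show ?thesis
  proof
    fix e assume "e \<in> parcs (contract G u v)"
    then obtain x y where "(x, y) \<in> parcs G" "e = (?f x, ?f y)"
      by (auto simp: contract_def)
    then show "fst e \<in> pverts (contract G u v)" "snd e \<in> pverts (contract G u v)" "fst e \<noteq> snd e"
      using arc[of x y] by (simp_all add: contract_def)
  next
    have "(b, a) \<in> parcs (contract G u v)" if "(a, b) \<in> parcs (contract G u v)" for a b
    proof -
      from that obtain x y where "(x, y) \<in> parcs G" "a = ?f x" "b = ?f y"
        by (auto simp: contract_def)
      then show ?thesis
        using imageI[OF arcs_symmetric, of x y "map_prod ?f ?f"] by (simp add: contract_def)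
    qed
    then show "symmetric (with_proj (contract G u v))"
      by (simp add: symmetric_def sym_def)
  next
    show "finite (pverts (contract G u v))" "finite (parcs (contract G u v))"
      using pair_finite_verts pair_finite_arcs by (simp_all add: contract_def)
  qed
qed

end

theory Submission
  imports Defs
begin

text \<open>
  Deletions preserve forests, and a forest admits no contraction at all; since \<open>K\<^sub>2\<^sub>,\<^sub>2\<close> is a cycle,
  it is not a bipartite minor of a forest.  Conversely, delete everything outside a given cycle.
  A cycle that is the whole graph is peripheral, so two of its vertices at distance two may be
  contracted, which leaves a cycle that is shorter by two together with a pendant edge.  Repeat
  until a cycle of length 4 is left; length 3 never occurs, by bipartiteness.
\<close>

section \<open>Cycles as lists of vertices\<close>

text \<open>Pairing with \<open>rotate1\<close> supplies the closing arc from the last vertex back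
  to the first, so a cycle becomes a plain vertex list without a marked start vertex.\<close>

definition cycle_arcs :: "'a list \<Rightarrow> ('a \<times> 'a) list" where
  "cycle_arcs xs = zip xs (rotate1 xs)"

lemma map_fst_cycle_arcs [simp]: "map fst (cycle_arcs xs) = xs"
  by (simp add: cycle_arcs_def)

lemma map_snd_cycle_arcs [simp]: "map snd (cycle_arcs xs) = rotate1 xs"
  by (simp add: cycle_arcs_def)

lemma length_cycle_arcs [simp]: "length (cycle_arcs xs) = length xs"
  by (simp add: cycle_arcs_def)

lemma cycle_verts_cycle_arcs [simp]: "cycle_verts (cycle_arcs xs) = set xs"
  by (metis cycle_verts_def list.set_map map_fst_cycle_arcs)

lemma cycle_arcs_map: "cycle_arcs (map f xs) = map (map_prod f f) (cycle_arcs xs)"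
  by (simp add: cycle_arcs_def rotate1_map zip_map_map map_prod_def)

text \<open>Tails followed by the end, and the start followed by heads, both spell out the vertex
  sequence of the walk. This trades the recursion for one list equation.\<close>

lemma pcas_iff_map: "pcas u p v \<longleftrightarrow> map fst p @ [v] = u # map snd p"
  by (induction u p v rule: pcas.induct) auto

lemma pawalk_verts_eq_map: "pcas u p v \<Longrightarrow> pawalk_verts u p = u # map snd p"
  by (induction u p v rule: pcas.induct) auto

text \<open>In a nonempty closed walk the heads are the tails rotated by one place, so the list of
  tails determines all arcs.\<close>

lemma (in pair_wf_digraph) undirected_cycle_iff:
  "undirected_cycle G p \<longleftrightarrow>
     (\<exists>xs. p = cycle_arcs xs \<and> distinct xs \<and> 3 \<le> length xs \<and> set (cycle_arcs xs) \<subseteq> parcs G)"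
proof
  assume "undirected_cycle G p"
  then obtain u where u: "awalk u p u" "distinct (tl (pawalk_verts u p))" "3 \<le> length p"
    by (auto simp: undirected_cycle_def cycle_def)
  then have cas: "pcas u p u" and arcs: "set p \<subseteq> parcs G"
    by (auto simp: awalk_def)
  from cas have map_eq: "map fst p @ [u] = u # map snd p"
    by (simp add: pcas_iff_map)
  from u(3) have "p \<noteq> []" by auto
  then have "rotate1 (map fst p) = map snd p"
    using map_eq by (cases p) auto
  moreover from this have "p = cycle_arcs (map fst p)"
    by (simp add: cycle_arcs_def zip_map_fst_snd)
  moreover have "distinct (map snd p)"
    using u(2) pawalk_verts_eq_map[OF cas] by simp
  ultimately show "\<exists>xs. p = cycle_arcs xs \<and> distinct xs \<and> 3 \<le> length xs
      \<and> set (cycle_arcs xs) \<subseteq> parcs G"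
    using u(3) arcs by (metis distinct1_rotate length_map)
next
  assume "\<exists>xs. p = cycle_arcs xs \<and> distinct xs \<and> 3 \<le> length xs \<and> set (cycle_arcs xs) \<subseteq> parcs G"
  then obtain xs where xs: "p = cycle_arcs xs" "distinct xs" "3 \<le> length xs"
    "set (cycle_arcs xs) \<subseteq> parcs G" by blast
  then obtain x ys where x: "xs = x # ys" by (cases xs) auto
  have cas: "pcas x p x"
    by (simp add: pcas_iff_map xs(1)) (simp add: x)
  \<comment> \<open>The first arc of the cycle, which certifies that its start is a vertex of
    \<open>G\<close>, as \<open>awalk\<close> demands.\<close>
  have "(x, hd (ys @ [x])) \<in> set (cycle_arcs xs)"
    by (cases ys) (auto simp: x cycle_arcs_def)
  then have "x \<in> pverts G" using xs(4) in_arcsD1 by blast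
  then have "awalk x p x" using xs cas by (simp add: awalk_def)
  moreover have "distinct (tl (pawalk_verts x p))"
    unfolding pawalk_verts_eq_map[OF cas] using xs(2) by (simp add: xs(1))
  moreover have "p \<noteq> []"
    by (simp add: xs(1) x cycle_arcs_def)
  ultimately show "undirected_cycle G p"
    using xs(1,3) by (auto simp: undirected_cycle_def cycle_def)
qed

lemma (in pair_wf_digraph) undirected_forest_iff:
  "undirected_forest G \<longleftrightarrow>
     \<not> (\<exists>xs. distinct xs \<and> 3 \<le> length xs \<and> set (cycle_arcs xs) \<subseteq> parcs G)"
  by (auto simp: undirected_forest_def undirected_cycle_iff)

text \<open>In the list description, a cycle of \<open>H\<close> is the same list read in
  \<open>G\<close>.\<close>

lemma undirected_forest_mono:
  assumes "pair_wf_digraph G" "pair_wf_digraph H" "parcs H \<subseteq> parcs G" "undirected_forest G"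
  shows "undirected_forest H"
  using assms(3,4) unfolding pair_wf_digraph.undirected_forest_iff[OF assms(1)]
    pair_wf_digraph.undirected_forest_iff[OF assms(2)] by blast

lemma undirected_forest_not_admissible: "undirected_forest G \<Longrightarrow> \<not> admissible G u v"
  by (auto simp: undirected_forest_def admissible_def peripheral_cycle_def)

section \<open>Minors and isomorphisms\<close>

lemma pair_graphI:
  assumes "finite (pverts G)" "parcs G \<subseteq> pverts G \<times> pverts G" "irrefl (parcs G)" "sym (parcs G)"
  shows "pair_graph G"
proof
  show "finite (parcs G)"
    using assms by (meson finite_SigmaI finite_subset)
  show "symmetric (with_proj G)"
    using assms(4) by (simp add: symmetric_def)
qed (use assms in \<open>auto simp: irrefl_def\<close>)

lemma (in pair_graph) sym_parcs: "sym (parcs G)"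
  using pair_sym_arcs by (simp add: symmetric_def)

lemma (in pair_graph) irrefl_parcs: "irrefl (parcs G)"
  using pair_no_loops by (force simp: irrefl_def)

lemma (in pair_graph) pair_graph_delete_vertex: "pair_graph (delete_vertex G v)"
  by (rule pair_graphI)
    (use pair_finite_verts irrefl_parcs sym_parcs in
      \<open>auto simp: delete_vertex_def irrefl_def sym_def dest: wellformed'\<close>)

lemma (in pair_graph) pair_graph_delete_edge: "pair_graph (delete_edge G u v)"
  by (rule pair_graphI)
    (use pair_finite_verts irrefl_parcs sym_parcs in
      \<open>auto simp: delete_edge_def irrefl_def sym_def dest: wellformed'\<close>)

lemma bipartite_minor_step_pair_graph:
  assumes "bipartite_minor_step G H" "pair_graph G"
  shows "pair_graph H"
  using assms
  by cases (auto simp: admissible_def pair_graph.pair_graph_delete_vertex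
      pair_graph.pair_graph_delete_edge pair_graph_contract)

lemma bipartite_minor_step_forest:
  assumes "bipartite_minor_step G H" "pair_graph G" "undirected_forest G"
  shows "undirected_forest H"
proof -
  have "pair_wf_digraph G" "pair_wf_digraph H"
    using assms(2) bipartite_minor_step_pair_graph[OF assms(1,2)]
    by (auto simp: pair_graph_def pair_digraph_def pair_fin_digraph_def)
  \<comment> \<open>A contraction may create new arcs, but in a forest that case is contradictory;
    only the deletions remain.\<close>
  moreover have "parcs H \<subseteq> parcs G"
    using assms(1,3)
    by cases (auto simp: delete_vertex_def delete_edge_def undirected_forest_not_admissible)
  ultimately show ?thesis
    using assms(3) undirected_forest_mono by blast
qed

lemma bipartite_minor_steps_forest:
  assumes "bipartite_minor_step\<^sup>*\<^sup>* G H" "pair_graph G" "undirected_forest G"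
  shows "pair_graph H \<and> undirected_forest H"
  using assms
  by induction (auto dest: bipartite_minor_step_pair_graph bipartite_minor_step_forest)

text \<open>Under \<open>with_proj\<close> tail and head are \<open>fst\<close> and
  \<open>snd\<close>, so compatibility with them forces the arc map to be
  \<open>map_prod h h\<close> for the vertex map \<open>h\<close>.\<close>

lemma digraph_iso_with_proj_iff:
  "digraph_iso (with_proj G) (with_proj H) \<longleftrightarrow>
     wf_digraph (with_proj G) \<and>
     (\<exists>h. inj_on h (pverts G) \<and> pverts H = h ` pverts G \<and> parcs H = map_prod h h ` parcs G)"
proof
  assume "digraph_iso (with_proj G) (with_proj H)"
  then obtain f where f: "pre_digraph.digraph_isomorphism (with_proj G) f"
    "with_proj H = app_iso f (with_proj G)"
    by (auto simp: digraph_iso_def)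
  have eqs: "pverts H = iso_verts f ` pverts G" "parcs H = iso_arcs f ` parcs G"
    "iso_tail f = fst" "iso_head f = snd"
    using f(2) by (auto simp: with_proj_def app_iso_def)
  have "iso_arcs f a = map_prod (iso_verts f) (iso_verts f) a" if "a \<in> parcs G" for a
    using f(1) that by (simp add: pre_digraph.digraph_isomorphism_def eqs prod_eq_iff)
  then have "parcs H = map_prod (iso_verts f) (iso_verts f) ` parcs G"
    unfolding eqs by (intro image_cong) auto
  then show "wf_digraph (with_proj G) \<and>
     (\<exists>h. inj_on h (pverts G) \<and> pverts H = h ` pverts G \<and> parcs H = map_prod h h ` parcs G)"
    using f(1) eqs(1) by (auto simp: pre_digraph.digraph_isomorphism_def)
next
  assume "wf_digraph (with_proj G) \<and>
     (\<exists>h. inj_on h (pverts G) \<and> pverts H = h ` pverts G \<and> parcs H = map_prod h h ` parcs G)"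
  then obtain h where wf: "wf_digraph (with_proj G)" and h: "inj_on h (pverts G)"
    "pverts H = h ` pverts G" "parcs H = map_prod h h ` parcs G" by blast
  let ?f = "\<lparr>iso_verts = h, iso_arcs = map_prod h h, iso_head = snd, iso_tail = fst\<rparr>"
  \<comment> \<open>Injectivity of \<open>h\<close> is known on vertices only; well-formedness
    carries it over to arcs.\<close>
  have "parcs G \<subseteq> pverts G \<times> pverts G"
    using wf_digraph.head_in_verts[OF wf] wf_digraph.tail_in_verts[OF wf] by fastforce
  then have "inj_on (map_prod h h) (parcs G)"
    using h(1) map_prod_inj_on inj_on_subset by blast
  then have "pre_digraph.digraph_isomorphism (with_proj G) ?f"
    using wf h(1) by (simp add: pre_digraph.digraph_isomorphism_def)
  moreover have "with_proj H = app_iso ?f (with_proj G)"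
    using h by (simp add: with_proj_def app_iso_def)
  ultimately show "digraph_iso (with_proj G) (with_proj H)"
    by (auto simp: digraph_iso_def)
qed

text \<open>A cycle of \<open>H\<close> is pulled back to \<open>G\<close> along the inverse of the
  vertex map.\<close>

lemma undirected_forest_iso:
  assumes "pair_wf_digraph G" "pair_wf_digraph H" "digraph_iso (with_proj G) (with_proj H)"
    "undirected_forest G"
  shows "undirected_forest H"
proof (rule ccontr)
  assume "\<not> undirected_forest H"
  then obtain xs where xs: "distinct xs" "3 \<le> length xs" "set (cycle_arcs xs) \<subseteq> parcs H"
    by (auto simp: pair_wf_digraph.undirected_forest_iff[OF assms(2)])
  obtain h where h: "inj_on h (pverts G)" "pverts H = h ` pverts G"
    "parcs H = map_prod h h ` parcs G"
    using assms(3) by (auto simp: digraph_iso_with_proj_iff)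
  let ?g = "the_inv_into (pverts G) h"
  \<comment> \<open>Every vertex of a cycle is the tail of one of its arcs, so \<open>xs\<close>
    lies in the range of \<open>h\<close>, where \<open>?g\<close> is injective.\<close>
  have "fst ` set (cycle_arcs xs) \<subseteq> pverts H"
    using xs(3) pair_wf_digraph.arc_fst_in_verts[OF assms(2)] by blast
  then have "set xs \<subseteq> h ` pverts G"
    using cycle_verts_cycle_arcs[of xs] h(2) by (simp add: cycle_verts_def)
  then have "distinct (map ?g xs)"
    using xs(1) inj_on_the_inv_into[OF h(1)] by (auto simp: distinct_map intro: inj_on_subset)
  moreover have "map_prod ?g ?g (map_prod h h a) = a" if "a \<in> parcs G" for a
    using that h(1) pair_wf_digraph.arc_fst_in_verts[OF assms(1)]
      pair_wf_digraph.arc_snd_in_verts[OF assms(1)]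
    by (cases a) (force simp: the_inv_into_f_f)
  then have "set (cycle_arcs (map ?g xs)) \<subseteq> parcs G"
    using xs(3) h(3) by (force simp: cycle_arcs_map)
  ultimately show False
    using xs(2) assms(4) pair_wf_digraph.undirected_forest_iff[OF assms(1)]
    by (metis length_map)
qed

lemma pair_graph_complete_bipartite: "pair_graph (complete_bipartite m n)"
  by (rule pair_graphI) (auto simp: complete_bipartite_def irrefl_def sym_def)

lemma not_undirected_forest_K22: "\<not> undirected_forest (complete_bipartite 2 2)"
proof -
  interpret pair_graph "complete_bipartite 2 2"
    by (rule pair_graph_complete_bipartite)
  have "set (cycle_arcs [Inl 0, Inr 0, Inl 1, Inr 1]) \<subseteq> parcs (complete_bipartite 2 2)"
    by (auto simp: cycle_arcs_def complete_bipartite_def)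
  then show ?thesis
    unfolding undirected_forest_iff by (intro notI) (force dest: spec)
qed

section \<open>Reducing a cycle to a 4-cycle\<close>

lemma bipartite_minor_step_trans:
  "bipartite_minor_step G G' \<Longrightarrow> bipartite_minor H G' \<Longrightarrow> bipartite_minor H G"
  unfolding bipartite_minor_def by (meson converse_rtranclp_into_rtranclp)

lemma bipartite_delete_vertex:
  assumes "bipartite G"
  shows "bipartite (delete_vertex G v)"
proof -
  obtain U V where "bipartition G U V"
    using assms by (auto simp: bipartite_def)
  then have "bipartition (delete_vertex G v) (U - {v}) (V - {v})"
    by (auto simp: bipartition_def delete_vertex_def)
  then show ?thesis by (auto simp: bipartite_def)
qed

lemma bipartite_delete_edge: "bipartite G \<Longrightarrow> bipartite (delete_edge G u v)"
  by (fastforce simp: bipartite_def bipartition_def delete_edge_def)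

text \<open>Renaming \<open>u\<close> to \<open>v\<close> maps \<open>U\<close> into
  \<open>U - {u}\<close> and fixes \<open>V\<close> pointwise, so these two sets are the new
  parts.\<close>

lemma bipartite_contract:
  assumes "same_part G u v" "u \<noteq> v"
  shows "bipartite (contract G u v)"
proof -
  obtain U V where B: "pverts G = U \<union> V" "U \<inter> V = {}" "parcs G \<subseteq> U \<times> V \<union> V \<times> U"
    and uv: "u \<in> U" "v \<in> U"
    using assms(1) by (auto simp: same_part_def bipartition_def)
  have "(id(u := v)) x \<in> U - {u}" if "x \<in> U" for x
    using that uv assms(2) by simp
  moreover have "(id(u := v)) x \<in> V" if "x \<in> V" for x
    using that uv B(2) by auto
  ultimately have "parcs (contract G u v) \<subseteq> (U - {u}) \<times> V \<union> V \<times> (U - {u})"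
    using B(3) by (auto simp: contract_def simp del: fun_upd_apply)
  then have "bipartition (contract G u v) (U - {u}) V"
    using B(1,2) uv by (auto simp: bipartition_def contract_def)
  then show ?thesis by (auto simp: bipartite_def)
qed

lemma same_part_if_common_neighbor:
  assumes "bipartite G" "(u, w) \<in> parcs G" "(w, v) \<in> parcs G"
  shows "same_part G u v"
proof -
  obtain U V where "bipartition G U V"
    using assms(1) by (auto simp: bipartite_def)
  \<comment> \<open>\<open>same_part\<close> refers to the first part only; the swapped bipartition
    serves when \<open>u\<close> and \<open>v\<close> lie in \<open>V\<close>.\<close>
  moreover from this have "bipartition G V U"
    by (auto simp: bipartition_def)
  moreover have "u \<in> U \<and> v \<in> U \<or> u \<in> V \<and> v \<in> V"
    using calculation(1) assms(2,3) by (auto simp: bipartition_def)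
  ultimately show ?thesis
    by (auto simp: same_part_def)
qed

lemma not_bipartite_triangle:
  assumes "bipartite G" "(u, w) \<in> parcs G" "(w, v) \<in> parcs G" "(v, u) \<in> parcs G"
  shows False
  using assms unfolding bipartite_def bipartition_def by blast

text \<open>Nothing is left after removing the cycle, so the number of components drops to
  0.\<close>

lemma nonseparating_spanning_cycle:
  assumes "cycle_verts p = pverts G"
  shows "nonseparating_cycle G p"
proof -
  \<comment> \<open>\<open>rtrancl_on\<close> is reflexive only on its vertex set. Over the empty
    set nothing reaches even itself, which rules out every nonempty candidate for a
    component.\<close>
  have "rtrancl_on {} r = {}" for r :: "'a rel"
    by (auto dest: in_rtrancl_on_in_F)
  then have "pre_digraph.sccs_verts (with_proj G \<restriction> {}) = {}"
    by (auto simp: pre_digraph.sccs_verts_def reachable_def)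
  then show ?thesis
    by (simp add: nonseparating_cycle_def num_components_def assms)
qed

text \<open>The path along \<open>v # ys\<close> and on to \<open>u\<close> closes up at
  \<open>v\<close> once \<open>u\<close> is renamed to \<open>v\<close>; \<open>w\<close> drops out
  of the cycle.\<close>

lemma cycle_arcs_contract:
  assumes "distinct (u # w # v # ys)" "set (cycle_arcs (u # w # v # ys)) \<subseteq> parcs G"
  shows "set (cycle_arcs (v # ys)) \<subseteq> parcs (contract G u v)"
proof -
  \<comment> \<open>By distinctness the renaming changes only the final \<open>u\<close> of the
    path.\<close>
  have "(id(u := v)) y = y" if "y \<in> set (v # ys)" for y
    using that assms(1) by auto
  then have "cycle_arcs (v # ys) =
      map (map_prod (id(u := v)) (id(u := v))) (zip (v # ys) (ys @ [u]))"
    by (simp add: cycle_arcs_def zip_map_map[symmetric] map_prod_def map_idI)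
  moreover have "set (zip (v # ys) (ys @ [u])) \<subseteq> parcs G"
    using assms(2) by (auto simp: cycle_arcs_def)
  ultimately show ?thesis
    by (auto simp: contract_def)
qed

lemma digraph_iso_K22:
  assumes "pair_graph G" "distinct [a, b, c, d]" "pverts G = {a, b, c, d}"
    "parcs G = {a, c} \<times> {b, d} \<union> {b, d} \<times> {a, c}"
  shows "digraph_iso (with_proj G) (with_proj (complete_bipartite 2 2))"
proof -
  interpret pair_graph G by fact
  \<comment> \<open>Going around the 4-cycle \<open>a\<close>, \<open>b\<close>, \<open>c\<close>,
    \<open>d\<close>, the vertices alternate between the two sides.\<close>
  let ?h = "\<lambda>x. if x = a then Inl 0 else if x = b then Inr 0 else if x = c then Inl 1
    else Inr (1::nat) :: nat + nat"
  have two: "{..<2} = {0, 1::nat}" by auto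
  have "inj_on ?h (pverts G)"
    using assms(2) by (auto simp: assms(3) inj_on_def)
  moreover have h: "?h ` {a, c} = Inl ` {..<2}" "?h ` {b, d} = Inr ` {..<2}"
    using assms(2) by (auto simp: two simp del: if_image_distrib)
  have "pverts G = {a, c} \<union> {b, d}"
    by (auto simp: assms(3))
  then have "pverts (complete_bipartite 2 2) = ?h ` pverts G"
    unfolding complete_bipartite_def by (simp only: image_Un h pair_pre_digraph.simps)
  moreover have "parcs (complete_bipartite 2 2) = map_prod ?h ?h ` parcs G"
    unfolding complete_bipartite_def assms(4)
    by (simp only: image_Un map_prod_surj_on[OF h(1) h(2)] map_prod_surj_on[OF h(2) h(1)]
        pair_pre_digraph.simps)
  ultimately show ?thesis
    unfolding digraph_iso_with_proj_iff using wf_digraph_axioms by (intro conjI exI[of _ ?h])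
qed

text \<open>The measure adds vertices and arcs because deleting an edge lowers only the arc count,
  while a contraction lowers the vertex count and does not raise the arc count. The list
  \<open>xs\<close> is generalized since a contraction changes the cycle.\<close>

lemma bipartite_minor_K22_if_cycle:
  assumes "pair_graph G" "bipartite G"
    and "distinct xs" "3 \<le> length xs" "set (cycle_arcs xs) \<subseteq> parcs G"
  shows "bipartite_minor (complete_bipartite 2 2) G"
  using assms
proof (induction "card (pverts G) + card (parcs G)" arbitrary: G xs rule: less_induct)
  case less
  interpret pair_graph G by fact
  let ?A = "set (cycle_arcs xs)"
  have "fst ` ?A \<subseteq> pverts G"
    using less.prems(5) by (intro image_subsetI arc_fst_in_verts) blast
  then have xs_verts: "set xs \<subseteq> pverts G"
    using cycle_verts_cycle_arcs[of xs] by (simp add: cycle_verts_def)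
  \<comment> \<open>Either something outside the cycle can be deleted, or \<open>G\<close> is the
    cycle itself. \<open>?A\<close> holds one orientation of each cycle edge, hence the
    converse.\<close>
  consider (vertex) v where "v \<in> pverts G" "v \<notin> set xs"
    | (edge) u v where "(u, v) \<in> parcs G" "(u, v) \<notin> ?A" "(v, u) \<notin> ?A"
    | (cycle) "pverts G = set xs" "parcs G \<subseteq> ?A \<union> ?A\<inverse>"
  proof (cases "pverts G \<subseteq> set xs")
    case True
    then have "pverts G = set xs" using xs_verts by (rule equalityI)
    then show ?thesis using edge cycle by (metis UnCI converse_iff subrelI)
  qed (use vertex in blast)
  then show ?case
  proof cases
    case vertex
    have "card (pverts (delete_vertex G v)) < card (pverts G)"
      unfolding delete_vertex_def pair_pre_digraph.simps
      using pair_finite_verts vertex(1) by (rule card_Diff1_less)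
    moreover have "card (parcs (delete_vertex G v)) \<le> card (parcs G)"
      using pair_finite_arcs by (auto simp: delete_vertex_def intro: card_mono)
    moreover have "?A \<subseteq> parcs (delete_vertex G v)"
    proof
      fix e assume e: "e \<in> ?A"
      \<comment> \<open>\<open>rotate1\<close> only permutes the list, so both ends of a cycle arc
        are entries of \<open>xs\<close>.\<close>
      have "fst e \<in> set xs" "snd e \<in> set xs"
        using set_zip_leftD[of "fst e" "snd e"] set_zip_rightD[of "fst e" "snd e"] e
        by (force simp: cycle_arcs_def)+
      then show "e \<in> parcs (delete_vertex G v)"
        using e less.prems(5) vertex by (auto simp: delete_vertex_def)
    qed
    ultimately have "bipartite_minor (complete_bipartite 2 2) (delete_vertex G v)"
      using less.prems by (intro less.hyps)
        (auto simp: pair_graph_delete_vertex bipartite_delete_vertex)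
    then show ?thesis
      using vertex by (blast intro: bipartite_minor_step_trans bipartite_minor_step.intros)
  next
    case edge
    have "card (parcs (delete_edge G u v)) < card (parcs G)"
      unfolding delete_edge_def pair_pre_digraph.simps
      using pair_finite_arcs edge(1) by (intro psubset_card_mono) auto
    moreover have "?A \<subseteq> parcs (delete_edge G u v)"
      using less.prems(5) edge by (auto simp: delete_edge_def)
    ultimately have "bipartite_minor (complete_bipartite 2 2) (delete_edge G u v)"
      using less.prems by (intro less.hyps)
        (auto simp: pair_graph_delete_edge bipartite_delete_edge, simp add: delete_edge_def)
    then show ?thesis
      using edge by (blast intro: bipartite_minor_step_trans bipartite_minor_step.intros)
  next
    case cycle
    obtain u w v ys where xs: "xs = u # w # v # ys"
      using less.prems(4) by (metis Suc_le_length_iff numeral_3_eq_3)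
    have uwv: "(u, w) \<in> ?A" "(w, v) \<in> ?A"
      by (auto simp: xs cycle_arcs_def)
    have sym: "?A\<inverse> \<subseteq> parcs G"
      using less.prems(5) sym_parcs by (auto dest: symD)
    \<comment> \<open>These are cycle lengths 3, 4 and at least 5. In the last case
      \<open>v # ys\<close> still has length at least 3; from length 5 a triangle arises, which the
      next round refutes by bipartiteness.\<close>
    consider "ys = []" | d where "ys = [d]" | "2 \<le> length ys"
      by (cases ys rule: remdups_adj.cases) auto
    then show ?thesis
    proof cases
      case 1
      then show ?thesis
        using less.prems(2,5) not_bipartite_triangle[of G u w v] by (auto simp: xs cycle_arcs_def)
    next
      case 2
      \<comment> \<open>Both orientations of the 4-cycle together are all arcs between the opposite
        pairs \<open>{u, v}\<close> and \<open>{w, d}\<close>.\<close>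
      have "?A \<union> ?A\<inverse> = {u, v} \<times> {w, d} \<union> {w, d} \<times> {u, v}"
        by (auto simp: xs 2 cycle_arcs_def)
      moreover have "parcs G = ?A \<union> ?A\<inverse>"
        using less.prems(5) cycle(2) sym by (intro equalityI Un_least)
      ultimately have "digraph_iso (with_proj G) (with_proj (complete_bipartite 2 2))"
        using less.prems(1,3) cycle(1) by (intro digraph_iso_K22[of _ u w v d]) (simp_all add: xs 2)
      then show ?thesis
        by (auto simp: bipartite_minor_def)
    next
      case 3
      have "undirected_cycle G (cycle_arcs xs)"
        using less.prems(3-5) by (auto simp: undirected_cycle_iff)
      \<comment> \<open>There is no chord, as every arc of \<open>G\<close> belongs to the cycle in
        one of the two orientations.\<close>
      moreover have "induced_cycle G (cycle_arcs xs)"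
        using cycle(2) by (auto simp: induced_cycle_def)
      ultimately have "peripheral_cycle G (cycle_arcs xs)"
        using cycle(1) by (simp add: peripheral_cycle_def nonseparating_spanning_cycle)
      moreover have uv: "u \<noteq> v" "same_part G u v"
        using less.prems(2,3,5) uwv by (auto simp: xs intro: same_part_if_common_neighbor)
      ultimately have adm: "admissible G u v"
        using uwv less.prems(5) sym unfolding admissible_def by blast
      have "card (pverts (contract G u v)) < card (pverts G)"
        unfolding contract_def pair_pre_digraph.simps
        using pair_finite_verts by (rule card_Diff1_less) (simp add: xs cycle(1))
      moreover have "card (parcs (contract G u v)) \<le> card (parcs G)"
        using pair_finite_arcs by (simp add: contract_def card_image_le)
      moreover have "set (cycle_arcs (v # ys)) \<subseteq> parcs (contract G u v)"
        using less.prems(3,5) by (intro cycle_arcs_contract[of u w]) (auto simp: xs)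
      ultimately have "bipartite_minor (complete_bipartite 2 2) (contract G u v)"
        using less.prems(1,3) uv 3
        by (intro less.hyps[of _ "v # ys"])
          (auto simp: xs pair_graph_contract bipartite_contract)
      then show ?thesis
        using adm by (blast intro: bipartite_minor_step_trans bipartite_minor_step.intros)
    qed
  qed
qed

theorem theorem2p5:
  fixes G :: "'a pair_pre_digraph"
  assumes "pair_graph G" and "bipartite G"
  shows "undirected_forest G \<longleftrightarrow> \<not> bipartite_minor (complete_bipartite 2 2) G"
proof
  assume forest: "undirected_forest G"
  show "\<not> bipartite_minor (complete_bipartite 2 2) G"
  proof
    assume "bipartite_minor (complete_bipartite 2 2) G"
    then obtain G' where G': "bipartite_minor_step\<^sup>*\<^sup>* G G'"
      "digraph_iso (with_proj G') (with_proj (complete_bipartite 2 2))"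
      by (auto simp: bipartite_minor_def)
    interpret G': pair_graph G'
      using bipartite_minor_steps_forest[OF G'(1) assms(1) forest] by simp
    interpret K: pair_graph "complete_bipartite 2 2"
      by (rule pair_graph_complete_bipartite)
    \<comment> \<open>Minor steps keep \<open>G'\<close> a forest, and the isomorphism would pass
      this on to the 4-cycle.\<close>
    have "undirected_forest (complete_bipartite 2 2)"
      using undirected_forest_iso[OF G'.pair_wf_digraph_axioms K.pair_wf_digraph_axioms G'(2)]
        bipartite_minor_steps_forest[OF G'(1) assms(1) forest] by simp
    then show False
      using not_undirected_forest_K22 by simp
  qed
next
  interpret pair_graph G by fact
  assume "\<not> bipartite_minor (complete_bipartite 2 2) G"
  then show "undirected_forest G"
    using bipartite_minor_K22_if_cycle[OF assms] unfolding undirected_forest_iff by blast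
qed

end
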